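(* Let $\mathcal X$ be a finite state space, and let $(Q_t)_{t\ge0}$ (resp. $(P_t)_{t\ge0}$) be the Markov semigroup with generator $G$ (resp. $L$) associated with an ergodic continuous-time Markov chain $(X_t)_{t\ge0}$ (resp. $(Y_t)_{t\ge0}$) on $\mathcal X$, with stationary distribution $\pi_Q$ (resp. $\pi$). Suppose that $L\in\mathcal S(G)$ with $G$ a normal generator, and let $(-\lambda_i)_{1\le i\le|\mathcal X|}$ be the common eigenvalues of $L$ and $G$. Put $\tau^Q_y=\inf\{t\ge0;X_t=y\}$ and $\tau^P_y=\inf\{t\ge0;Y_t=y\}$. Then $$\sum_{x,y\in\mathcal X}\mathbb E_x(\tau^Q_y)\pi_Q(x)\pi_Q(y)=\sum_{x,y\in\mathcal X}\mathbb E_x(\tau_y^P)\pi(x)\pi(y)=\sum_{i=1,\ \lambda_i\ne0}^{|\mathcal X|}\frac1{\lambda_i}.$$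
   Context: $L\in\mathcal S(G)$ means that there is a bounded linear operator $\Lambda:\ell^2(\pi_Q)\to\ell^2(\pi)$ with bounded inverse such that $L\Lambda=\Lambda G$ (so $L$ and $G$ have the same eigenvalues with multiplicity). $G$ is normal if it commutes with its adjoint in $\ell^2(\pi_Q)$, where $\langle f,g\rangle_{\pi_Q}=\sum_xf(x)\overline{g(x)}\pi_Q(x)$. *)

theory Defs
  imports "HOL-Probability.Probability"
begin

text \<open>The state space is a finite type \<open>'x\<close>. Kernels on it are matrices \<open>real ^ 'x ^ 'x\<close> with entry
  \<open>A $ x $ y\<close> for the pair \<open>(x, y)\<close>; complex functions on it are vectors \<open>complex ^ 'x\<close>.\<close>

definition stochastic_matrix :: "real ^ 'x ^ 'x::finite \<Rightarrow> bool" where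
  "stochastic_matrix A \<longleftrightarrow> (\<forall>x y. A $ x $ y \<ge> 0) \<and> (\<forall>x. (\<Sum>y\<in>UNIV. A $ x $ y) = 1)"

text \<open>Semigroups are indexed by \<open>t \<ge> 0\<close>; values at negative times are irrelevant throughout.\<close>

definition markov_semigroup :: "(real \<Rightarrow> real ^ 'x ^ 'x::finite) \<Rightarrow> bool" where
  "markov_semigroup P \<longleftrightarrow>
     (\<forall>t\<ge>0. stochastic_matrix (P t)) \<and> P 0 = mat 1 \<and>
     (\<forall>s\<ge>0. \<forall>t\<ge>0. P (s + t) = P s ** P t)"

definition has_generator :: "(real \<Rightarrow> real ^ 'x ^ 'x::finite) \<Rightarrow> real ^ 'x ^ 'x \<Rightarrow> bool" where
  "has_generator P L \<longleftrightarrow> ((\<lambda>t. (1 / t) *\<^sub>R (P t - mat 1)) \<longlongrightarrow> L) (at_right 0)"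

text \<open>On a finite state space, a continuous-time chain is ergodic iff it is irreducible: positive
  recurrence is then automatic, and there is no periodicity in continuous time.\<close>

definition ergodic :: "(real \<Rightarrow> real ^ 'x ^ 'x::finite) \<Rightarrow> bool" where
  "ergodic P \<longleftrightarrow> (\<forall>x y. \<exists>t\<ge>0. P t $ x $ y > 0)"

definition stationary_distribution :: "(real \<Rightarrow> real ^ 'x ^ 'x::finite) \<Rightarrow> real ^ 'x \<Rightarrow> bool" where
  "stationary_distribution P \<pi> \<longleftrightarrow>
     (\<forall>x. \<pi> $ x \<ge> 0) \<and> (\<Sum>x\<in>UNIV. \<pi> $ x) = 1 \<and> (\<forall>t\<ge>0. \<pi> v* P t = \<pi>)"

text \<open>\<open>M x\<close> is the law of the chain started at \<open>x\<close>, so that \<open>M\<close> is a family of probability measures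
  carrying the one process \<open>X\<close>. The Markov property is stated with respect to the natural filtration
  in its elementary form, and almost all paths are right-continuous for the discrete topology.\<close>

definition markov_chain ::
    "(real \<Rightarrow> real ^ 'x ^ 'x::finite) \<Rightarrow> ('x \<Rightarrow> 'w measure) \<Rightarrow> (real \<Rightarrow> 'w \<Rightarrow> 'x) \<Rightarrow> bool" where
  "markov_chain P M X \<longleftrightarrow> (\<forall>x.
     prob_space (M x) \<and>
     (\<forall>t\<ge>0. X t \<in> measurable (M x) (count_space UNIV)) \<and>
     (AE \<omega> in M x. X 0 \<omega> = x) \<and>
     (AE \<omega> in M x. \<forall>t\<ge>0. \<forall>\<^sub>F s in at_right t. X s \<omega> = X t \<omega>) \<and>
     (\<forall>(n::nat) (t::nat \<Rightarrow> real) (y::nat \<Rightarrow> 'x) h z.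
        0 \<le> t 0 \<and> (\<forall>i<n. t i \<le> t (Suc i)) \<and> 0 \<le> h \<longrightarrow>
        measure (M x) {\<omega> \<in> space (M x). (\<forall>i\<le>n. X (t i) \<omega> = y i) \<and> X (t n + h) \<omega> = z} =
        measure (M x) {\<omega> \<in> space (M x). \<forall>i\<le>n. X (t i) \<omega> = y i} * P h $ y n $ z))"

text \<open>The infimum of the empty set is \<open>\<infinity>\<close>.\<close>

definition hitting_time :: "(real \<Rightarrow> 'w \<Rightarrow> 'x) \<Rightarrow> 'x \<Rightarrow> 'w \<Rightarrow> ennreal" where
  "hitting_time X y \<omega> = (INF t\<in>{t. 0 \<le> t \<and> X t \<omega> = y}. ennreal t)"

definition expected_hitting_time ::
    "('x \<Rightarrow> 'w measure) \<Rightarrow> (real \<Rightarrow> 'w \<Rightarrow> 'x) \<Rightarrow> 'x \<Rightarrow> 'x \<Rightarrow> ennreal" where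
  "expected_hitting_time M X x y = (\<integral>\<^sup>+\<omega>. hitting_time X y \<omega> \<partial>M x)"

abbreviation complexify :: "real ^ 'n ^ 'm \<Rightarrow> complex ^ 'n ^ 'm" where
  "complexify A \<equiv> map_matrix complex_of_real A"

definition l2_inner :: "real ^ 'x::finite \<Rightarrow> complex ^ 'x \<Rightarrow> complex ^ 'x \<Rightarrow> complex" where
  "l2_inner \<pi> f g = (\<Sum>x\<in>UNIV. f $ x * cnj (g $ x) * complex_of_real (\<pi> $ x))"

definition l2_norm :: "real ^ 'x::finite \<Rightarrow> complex ^ 'x \<Rightarrow> real" where
  "l2_norm \<pi> f = sqrt (Re (l2_inner \<pi> f f))"

definition l2_bounded_operator ::
    "real ^ 'x::finite \<Rightarrow> real ^ 'x \<Rightarrow> (complex ^ 'x \<Rightarrow> complex ^ 'x) \<Rightarrow> bool" where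
  "l2_bounded_operator \<pi>1 \<pi>2 T \<longleftrightarrow>
     Vector_Spaces.linear vector_scalar_mult vector_scalar_mult T \<and>
     (\<exists>C. \<forall>f. l2_norm \<pi>2 (T f) \<le> C * l2_norm \<pi>1 f)"

definition similar_generators ::
    "real ^ 'x::finite \<Rightarrow> real ^ 'x \<Rightarrow> real ^ 'x ^ 'x \<Rightarrow> real ^ 'x ^ 'x \<Rightarrow> bool" where
  "similar_generators \<pi>\<^sub>Q \<pi> G L \<longleftrightarrow>
     (\<exists>\<Lambda>. l2_bounded_operator \<pi>\<^sub>Q \<pi> \<Lambda> \<and> bij \<Lambda> \<and> l2_bounded_operator \<pi> \<pi>\<^sub>Q (inv \<Lambda>) \<and>
          (\<forall>f. complexify L *v \<Lambda> f = \<Lambda> (complexify G *v f)))"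

definition l2_normal :: "real ^ 'x::finite \<Rightarrow> real ^ 'x ^ 'x \<Rightarrow> bool" where
  "l2_normal \<pi> G \<longleftrightarrow>
     (\<exists>G'. l2_bounded_operator \<pi> \<pi> G' \<and>
           (\<forall>f g. l2_inner \<pi> (complexify G *v f) g = l2_inner \<pi> f (G' g)) \<and>
           (\<forall>f. complexify G *v G' f = G' (complexify G *v f)))"

text \<open>\<open>\<mu> 1, \<dots>, \<mu> CARD('x)\<close> lists the eigenvalues of \<open>A\<close> with algebraic multiplicity, that is, the
  characteristic polynomial of \<open>A\<close> factors accordingly.\<close>

definition lists_eigenvalues :: "real ^ 'x ^ 'x::finite \<Rightarrow> (nat \<Rightarrow> complex) \<Rightarrow> bool" where
  "lists_eigenvalues A \<mu> \<longleftrightarrow> (\<forall>z. det (mat z - complexify A) = (\<Prod>i=1..CARD('x). z - \<mu> i))"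

end

theory Submission
  imports Defs
begin

text \<open>For a single ergodic chain with generator \<open>L\<close> and stationary distribution \<open>\<pi>\<close>, the mean time to hit a
  target drawn from \<open>\<pi>\<close> is a function of the spectrum of \<open>L\<close> alone. Write \<open>\<Pi> = 1 \<pi>\<^sup>T\<close> and let
  \<open>N\<close> be the inverse of \<open>\<Pi> - L\<close>, the fundamental matrix. The function
  \<open>h x = (N y y - N x y) / \<pi> y\<close> solves Poisson's equation \<open>L h = -1\<close> off \<open>y\<close> with \<open>h y = 0\<close>, so it is
  the mean hitting time of \<open>y\<close> from \<open>x\<close>. Averaging over \<open>x\<close> and \<open>y\<close> and using \<open>\<pi> N = \<pi>\<close> leaves
  \<open>tr N - 1\<close>. By \<open>trace_inverse_fundamental\<close> this is the sum of \<open>1 / \<lambda>\<close> over the nonzero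
  eigenvalues \<open>\<lambda>\<close> of \<open>-L\<close>, because \<open>\<Pi>\<close> merely replaces the simple eigenvalue 0 by 1. Similar
  generators have the same characteristic polynomial, so the sums for both chains agree.

  The probabilistic identification of \<open>h\<close> avoids the strong Markov property and jump chains. It
  observes the chain along the grid of multiples of \<open>\<delta> = 2\<^sup>-\<^sup>n\<close>. There the hitting time is a
  sum of indicators, and the elementary Markov property determines its expectation
  (\<open>skeleton_expectation\<close>) by Poisson's equation for \<open>(P \<delta> - 1) / \<delta>\<close>. As \<open>n\<close> grows the grid hitting times
  decrease almost surely to the true one by right-continuity, while the difference quotients converge
  to \<open>L\<close> and hence the solutions to \<open>h\<close> (\<open>expected_hitting_time_eq\<close>). Ergodicity
  enters through the invertibility of \<open>\<Pi> - L\<close> and the positivity of \<open>\<pi>\<close>.\<close>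

section \<open>Determinants, inverses and traces\<close>

lemma tendsto_det:
  fixes A :: "'b \<Rightarrow> 'a::real_normed_field ^ 'n ^ 'n"
  assumes "(A \<longlongrightarrow> B) F"
  shows "((\<lambda>t. det (A t)) \<longlongrightarrow> det B) F"
  unfolding det_def by (intro tendsto_intros assms)

lemma matrix_inv_inverse:
  fixes A :: "'a::field ^ 'n ^ 'n"
  assumes "invertible A"
  shows "A ** matrix_inv A = mat 1" and "matrix_inv A ** A = mat 1"
  using someI_ex[OF assms[unfolded invertible_def]] unfolding matrix_inv_def by auto

lemma matrix_inv_unique:
  fixes A B :: "'a::field ^ 'n ^ 'n"
  assumes "A ** B = mat 1"
  shows "invertible A" and "matrix_inv A = B"
proof -
  show inv: "invertible A" using assms invertible_right_inverse by blast
  have "matrix_inv A = matrix_inv A ** (A ** B)" by (simp add: assms)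
  also have "\<dots> = B" using matrix_inv_inverse[OF inv] by (simp add: matrix_mul_assoc)
  finally show "matrix_inv A = B" .
qed

text \<open>Cramer's rule exhibits the entries of the inverse as rational functions of the entries of the
  matrix. Continuity of the inverse follows from this without any matrix norm.\<close>

lemma matrix_inv_nth_Cramer:
  fixes A :: "'a::field ^ 'n ^ 'n"
  assumes "invertible A"
  shows "matrix_inv A $ k $ l = det (\<chi> i j. if j = k then mat 1 $ i $ l else A $ i $ j) / det A"
proof -
  have "A *v (\<chi> k. matrix_inv A $ k $ l) = (\<chi> i. mat 1 $ i $ l)"
    by (subst matrix_inv_inverse(1)[OF assms, symmetric])
       (simp add: vec_eq_iff matrix_vector_mult_def matrix_matrix_mult_def)
  then have "(\<chi> k. matrix_inv A $ k $ l) = 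
      (\<chi> k. det (\<chi> i j. if j = k then (\<chi> i. mat 1 $ i $ l) $ i else A $ i $ j) / det A)"
    using assms by (subst (asm) cramer) (auto simp: invertible_det_nz)
  from this[THEN arg_cong, of "\<lambda>v. v $ k"] show ?thesis by (simp only: vec_lambda_beta)
qed

lemma
  fixes A :: "'b \<Rightarrow> 'a::real_normed_field ^ 'n ^ 'n"
  assumes A: "(A \<longlongrightarrow> B) F" and inv: "invertible B"
  shows eventually_invertible: "\<forall>\<^sub>F t in F. invertible (A t)"
    and tendsto_matrix_inv: "((\<lambda>t. matrix_inv (A t)) \<longlongrightarrow> matrix_inv B) F"
proof -
  have "\<forall>\<^sub>F t in F. det (A t) \<noteq> 0"
    using tendsto_det[OF A] inv invertible_det_nz tendsto_imp_eventually_ne by blast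
  then show ev: "\<forall>\<^sub>F t in F. invertible (A t)"
    by (simp add: invertible_det_nz)
  show "((\<lambda>t. matrix_inv (A t)) \<longlongrightarrow> matrix_inv B) F"
  proof (intro vec_tendstoI)
    fix k l
    have "((\<lambda>t. (\<chi> i j. if j = k then mat 1 $ i $ l else A t $ i $ j) :: 'a^'n^'n) \<longlongrightarrow>
        (\<chi> i j. if j = k then mat 1 $ i $ l else B $ i $ j)) F"
      by (intro vec_tendstoI) (auto intro!: tendsto_vec_nth A)
    then have "((\<lambda>t. det (\<chi> i j. if j = k then mat 1 $ i $ l else A t $ i $ j) / det (A t)) \<longlongrightarrow>
        det (\<chi> i j. if j = k then mat 1 $ i $ l else B $ i $ j) / det B) F"
      using inv by (intro tendsto_divide tendsto_det A) (auto simp: invertible_det_nz)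
    then show "((\<lambda>t. matrix_inv (A t) $ k $ l) \<longlongrightarrow> matrix_inv B $ k $ l) F"
      unfolding matrix_inv_nth_Cramer[OF inv]
      by (rule Lim_transform_eventually) (use ev in eventually_elim, simp add: matrix_inv_nth_Cramer)
  qed
qed

lemma scalar_matrix_mult: "(mat c ** A) $ i $ j = c * A $ i $ j"
  and matrix_mult_scalar: "(A ** mat c) $ i $ j = A $ i $ j * c"
  for A :: "'a::comm_ring_1 ^ 'n ^ 'n"
  by (simp_all add: matrix_matrix_mult_def mat_def if_distrib if_distribR cong: if_cong)

lemma matrix_diff_ldistrib: "A ** (B - C) = A ** B - A ** C"
  and matrix_diff_rdistrib: "(B - C) ** A = B ** A - C ** A"
  and matrix_add_rdistrib: "(B + C) ** A = B ** A + C ** A"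
  for A :: "'a::ring_1 ^ 'n ^ 'n"
  by (simp_all add: vec_eq_iff matrix_matrix_mult_def algebra_simps sum_subtractf sum.distrib)

lemma mat_commute: "A ** mat c = mat c ** A"
  for A :: "'a::comm_ring_1 ^ 'n ^ 'n"
  by (simp add: vec_eq_iff scalar_matrix_mult matrix_mult_scalar mult.commute)

text \<open>In the Leibniz expansion only the identity permutation contributes at first order, because every
  other permutation picks at least two off-diagonal entries and each of these is a multiple of
  \<open>s\<close>.\<close>

lemma DERIV_det_perturbed_identity:
  fixes B :: "'a::real_normed_field ^ 'n ^ 'n"
  shows "((\<lambda>s. det (mat 1 + mat s ** B)) has_field_derivative trace B) (at 0)"
proof -
  define D where "D p = (\<Sum>i\<in>UNIV. B $ i $ p i * (\<Prod>j\<in>UNIV - {i}. mat 1 $ j $ p j))" for p :: "'n \<Rightarrow> 'n"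
  have "((\<lambda>s. \<Prod>i\<in>UNIV. mat 1 $ i $ p i + s * B $ i $ p i) has_field_derivative D p) (at 0)" for p
  proof -
    have "((\<lambda>s. \<Prod>i\<in>UNIV. mat 1 $ i $ p i + s * B $ i $ p i) has_field_derivative
        (\<Sum>i\<in>UNIV. B $ i $ p i * (\<Prod>j\<in>UNIV - {i}. mat 1 $ j $ p j + 0 * B $ j $ p j))) (at 0)"
      by (rule has_field_derivative_prod) (auto intro!: derivative_eq_intros)
    then show ?thesis by (simp add: D_def)
  qed
  then have "((\<lambda>s. det (mat 1 + mat s ** B)) has_field_derivative
      (\<Sum>p | p permutes UNIV. of_int (sign p) * D p)) (at 0)"
    unfolding det_def by (auto simp: scalar_matrix_mult intro!: derivative_eq_intros sum.cong)
  also have "(\<Sum>p | p permutes UNIV. of_int (sign p) * D p) = (\<Sum>p\<in>{id}. of_int (sign p) * D p)"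
  proof (rule sum.mono_neutral_right)
    show "\<forall>p\<in>{p. p permutes UNIV} - {id}. of_int (sign p) * D p = 0"
    proof
      fix p :: "'n \<Rightarrow> 'n" assume p: "p \<in> {p. p permutes UNIV} - {id}"
      \<comment> \<open>Even without its entry in row \<open>i\<close>, the product for \<open>p\<close> keeps an off-diagonal factor.\<close>
      have moved: "\<exists>j. j \<noteq> i \<and> p j \<noteq> j" for i
      proof (rule ccontr)
        assume "\<not> ?thesis"
        then have fixed: "p j = j" if "j \<noteq> i" for j using that by auto
        have "inj p" using p by (auto simp: permutes_inj)
        then have "p i = i" by (metis fixed injD)
        then have "p j = j" for j by (cases "j = i") (simp_all add: fixed)
        then have "p = id" by (simp add: fun_eq_iff)
        with p show False by simp
      qed
      have "(\<Prod>j\<in>UNIV - {i}. mat 1 $ j $ p j) = (0 :: 'a)" for i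
      proof (rule prod_zero)
        obtain j where "j \<noteq> i" "p j \<noteq> j" using moved by blast
        then show "\<exists>j\<in>UNIV - {i}. mat 1 $ j $ p j = (0 :: 'a)"
          by (intro bexI[of _ j]) (auto simp: mat_def)
      qed simp
      then have "D p = 0" unfolding D_def by (simp only: mult_zero_right sum.neutral_const)
      then show "of_int (sign p) * D p = 0" by simp
    qed
  qed (auto simp: permutes_id)
  also have "\<dots> = trace B" by (simp add: D_def trace_def mat_def)
  finally show ?thesis .
qed

text \<open>This is the logarithmic derivative of the characteristic polynomial. Writing \<open>R\<close> for the inverse
  of \<open>z + A\<close>, the factorisation \<open>(s + z) + A = (z + A)(1 + s R)\<close> reduces the derivative at \<open>z\<close> to the
  one at the identity matrix. The trace of the resolvent is thus available without any
  diagonalisation.\<close>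

lemma trace_resolvent:
  fixes A :: "'a::real_normed_field ^ 'n ^ 'n"
  assumes fac: "\<And>z. det (mat z + A) = (\<Prod>i\<in>I. z + c i)"
    and nz: "\<And>i. i \<in> I \<Longrightarrow> z + c i \<noteq> 0"
  shows "invertible (mat z + A)"
    and "trace (matrix_inv (mat z + A)) = (\<Sum>i\<in>I. 1 / (z + c i))"
proof -
  let ?q = "\<Prod>i\<in>I. z + c i"
  have q: "?q \<noteq> 0" 
  proof (cases "finite I")
    case True then show ?thesis using nz by auto
  qed simp
  then show inv: "invertible (mat z + A)"
    by (simp add: invertible_det_nz fac)
  define R where "R = matrix_inv (mat z + A)"
  have "(mat z + A) ** (mat s ** R) = mat s ** ((mat z + A) ** R)" for s
    by (metis mat_commute matrix_mul_assoc)
  then have "(mat z + A) ** (mat 1 + mat s ** R) = mat (s + z) + A" for s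
    using matrix_inv_inverse(1)[OF inv]
    by (simp add: matrix_add_ldistrib R_def) (simp add: vec_eq_iff mat_def)
  then have "det (mat z + A) * det (mat 1 + mat s ** R) = det (mat (s + z) + A)" for s
    by (metis det_mul)
  then have eq: "?q * det (mat 1 + mat s ** R) = (\<Prod>i\<in>I. s + z + c i)" for s
    by (simp add: fac)
  have "((\<lambda>s. ?q * det (mat 1 + mat s ** R)) has_field_derivative ?q * trace R) (at 0)"
    by (intro DERIV_cmult DERIV_det_perturbed_identity)
  moreover have "((\<lambda>s. \<Prod>i\<in>I. s + z + c i) has_field_derivative
      (\<Prod>i\<in>I. 0 + z + c i) * (\<Sum>i\<in>I. 1 / (0 + z + c i))) (at 0)"
    using nz by (intro has_field_derivative_prod') (auto intro!: derivative_eq_intros)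
  ultimately have "?q * trace R = ?q * (\<Sum>i\<in>I. 1 / (z + c i))"
    unfolding eq by (auto dest: DERIV_unique)
  then show "trace (matrix_inv (mat z + A)) = (\<Sum>i\<in>I. 1 / (z + c i))"
    using q by (simp add: R_def)
qed

section \<open>The trace of the fundamental matrix\<close>

text \<open>For a probability vector \<open>p\<close> this is the projection onto the constants \<open>1 p\<^sup>T\<close>.\<close>

definition const_rows :: "'a ^ 'n \<Rightarrow> 'a ^ 'n ^ 'n" where
  "const_rows p = (\<chi> x y. p $ y)"

lemma mult_const_rows_eq_0:
  fixes A :: "'a::comm_ring_1 ^ 'n ^ 'n"
  assumes "A *v 1 = 0"
  shows "A ** const_rows p = 0"
  using assms
  by (simp add: const_rows_def vec_eq_iff matrix_matrix_mult_def matrix_vector_mult_def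
      flip: sum_distrib_right)

lemma const_rows_mult_eq_0:
  fixes A :: "'a::comm_ring_1 ^ 'n ^ 'n"
  assumes "p v* A = 0"
  shows "const_rows p ** A = 0"
  using assms
  by (simp add: const_rows_def vec_eq_iff matrix_matrix_mult_def vector_matrix_mult_def mult.commute)

lemma const_rows_idem:
  fixes p :: "'a::comm_ring_1 ^ 'n"
  assumes "(\<Sum>x\<in>UNIV. p $ x) = 1"
  shows "const_rows p ** const_rows p = const_rows p"
  using assms
  by (simp add: const_rows_def vec_eq_iff matrix_matrix_mult_def flip: sum_distrib_right)

text \<open>The projection \<open>1 p\<^sup>T\<close> is annihilated by \<open>A\<close> from both sides, so the resolvent of \<open>A + 1 p\<^sup>T\<close> at
  \<open>z\<close> is that of \<open>A\<close> corrected by \<open>1 p\<^sup>T / (z (z + 1))\<close>. In the trace the correction moves the pole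
  \<open>1 / z\<close> contributed by the eigenvalue 0 to \<open>1 / (z + 1)\<close>, and \<open>z \<rightarrow> 0\<close> leaves the reciprocals of
  the nonzero eigenvalues.\<close>

lemma trace_inverse_fundamental:
  fixes A :: "'a::real_normed_field ^ 'n ^ 'n"
  assumes A1: "A *v 1 = 0" and pA: "p v* A = 0" and p1: "(\<Sum>x\<in>UNIV. p $ x) = 1"
    and inv: "invertible (A + const_rows p)"
    and I: "finite I" and fac: "\<And>z. det (mat z + A) = (\<Prod>i\<in>I. z + c i)"
  shows "trace (matrix_inv (A + const_rows p)) = 1 + (\<Sum>i | i \<in> I \<and> c i \<noteq> 0. 1 / c i)"
proof -
  let ?\<Pi> = "const_rows p"
  define S where "S z = (\<Sum>i | i \<in> I \<and> c i \<noteq> 0. 1 / (z + c i))" for z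
  \<comment> \<open>The algebraic multiplicity of the eigenvalue 0; invertibility of \<open>A + 1 p\<^sup>T\<close> will force it to
    be 1.\<close>
  define m :: 'a where "m = of_nat (card {i \<in> I. c i = 0})"
  have T: "trace (matrix_inv (mat z + (A + ?\<Pi>))) = m / z + S z - 1 / (z * (z + 1))"
    if z: "z \<noteq> 0" "z + 1 \<noteq> 0" "\<And>i. i \<in> I \<Longrightarrow> z + c i \<noteq> 0" for z
  proof -
    define R where "R = matrix_inv (mat z + A)"
    have R: "(mat z + A) ** R = mat 1" and tR: "trace R = (\<Sum>i\<in>I. 1 / (z + c i))"
      using trace_resolvent[OF fac z(3)] matrix_inv_inverse by (auto simp: R_def)
    have A\<Pi>: "A ** ?\<Pi> = 0" by (rule mult_const_rows_eq_0[OF A1])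
    have \<Pi>A: "?\<Pi> ** A = 0" by (rule const_rows_mult_eq_0[OF pA])
    have \<Pi>\<Pi>: "?\<Pi> ** ?\<Pi> = ?\<Pi>"
      by (rule const_rows_idem[OF p1])
    have "?\<Pi> ** (mat z + A) = mat z ** ?\<Pi>"
      by (simp add: matrix_add_ldistrib \<Pi>A mat_commute)
    then have "?\<Pi> = mat z ** (?\<Pi> ** R)"
      by (metis R matrix_mul_assoc matrix_mul_rid)
    then have \<Pi>R: "(?\<Pi> ** R) $ i $ j = ?\<Pi> $ i $ j / z" for i j
      using z(1) by (metis nonzero_mult_div_cancel_left scalar_matrix_mult)
    have "(mat z + A + ?\<Pi>) ** (mat (1 / (z * (z + 1))) ** ?\<Pi>) =
      mat (1 / (z * (z + 1))) ** ((mat z + A + ?\<Pi>) ** ?\<Pi>)"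
      by (metis mat_commute matrix_mul_assoc)
    also have "((mat z + A + ?\<Pi>) ** ?\<Pi>) = mat (z + 1) ** ?\<Pi>"
      by (simp add: matrix_add_rdistrib A\<Pi> \<Pi>\<Pi>) (simp add: vec_eq_iff scalar_matrix_mult algebra_simps)
    finally have *: "((mat z + A + ?\<Pi>) ** (mat (1 / (z * (z + 1))) ** ?\<Pi>)) $ i $ j = ?\<Pi> $ i $ j / z" for i j
      using z by (simp add: scalar_matrix_mult)
    have "(mat z + A + ?\<Pi>) ** (R - mat (1 / (z * (z + 1))) ** ?\<Pi>) = mat 1"
      unfolding matrix_diff_ldistrib unfolding matrix_add_rdistrib[of "mat z + A" ?\<Pi> R] R
      by (simp add: vec_eq_iff \<Pi>R *)
    then have "matrix_inv (mat z + (A + ?\<Pi>)) = R - mat (1 / (z * (z + 1))) ** ?\<Pi>"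
      using matrix_inv_unique(2) by (simp add: add.assoc)
    then have "trace (matrix_inv (mat z + (A + ?\<Pi>))) = trace R - 1 / (z * (z + 1))"
      using p1 by (simp add: trace_sub) (simp add: trace_def scalar_matrix_mult const_rows_def flip: sum_divide_distrib)
    moreover have "(\<Sum>i\<in>I. 1 / (z + c i)) = m / z + S z"
    proof -
      have "(\<Sum>i\<in>I. 1 / (z + c i)) = (\<Sum>i\<in>{i\<in>I. c i = 0} \<union> {i\<in>I. c i \<noteq> 0}. 1 / (z + c i))"
        by (rule sum.cong) auto
      also have "\<dots> = (\<Sum>i\<in>{i\<in>I. c i = 0}. 1 / (z + c i)) + S z"
        using I unfolding S_def by (intro sum.union_disjoint) auto
      also have "(\<Sum>i\<in>{i\<in>I. c i = 0}. 1 / (z + c i)) = (\<Sum>i\<in>{i\<in>I. c i = 0}. 1 / z)"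
        by (rule sum.cong) auto
      finally show ?thesis by (simp add: m_def)
    qed
    ultimately show ?thesis using tR by simp
  qed
  have ev: "\<forall>\<^sub>F z in at 0. z \<noteq> 0 \<and> z + 1 \<noteq> 0 \<and> (\<forall>i\<in>I. z + c i \<noteq> 0)"
  proof -
    have ne: "\<forall>\<^sub>F z in at 0. z \<noteq> a" for a :: 'a
      using tendsto_imp_eventually_ne[OF tendsto_ident_at, of 0 a UNIV]
      by (cases "a = 0") (auto simp: eventually_at_filter)
    have "z + a \<noteq> 0 \<longleftrightarrow> z \<noteq> - a" for z a :: 'a by (simp add: eq_neg_iff_add_eq_0)
    then show ?thesis using ne I by (auto simp: eventually_conj_iff eventually_ball_finite_distrib)
  qed
  have lim: "((\<lambda>z. trace (matrix_inv (mat z + (A + ?\<Pi>)))) \<longlongrightarrow> trace (matrix_inv (A + ?\<Pi>))) (at 0)"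
  proof -
    have "((\<lambda>z. mat z $ i $ j) \<longlongrightarrow> (0 :: 'a ^ 'n ^ 'n) $ i $ j) (at 0)" for i j
      by (cases "i = j") (auto simp: mat_def)
    then have "((\<lambda>z. mat z + (A + ?\<Pi>)) \<longlongrightarrow> 0 + (A + ?\<Pi>)) (at 0)"
      by (intro tendsto_add tendsto_const vec_tendstoI)
    then have "((\<lambda>z. matrix_inv (mat z + (A + ?\<Pi>))) \<longlongrightarrow> matrix_inv (A + ?\<Pi>)) (at 0)"
      using inv by (intro tendsto_matrix_inv) auto
    then show ?thesis unfolding trace_def by (intro tendsto_intros)
  qed
  have S: "(S \<longlongrightarrow> S 0) (at 0)"
    unfolding S_def by (intro tendsto_intros) (auto intro!: tendsto_eq_intros)
  \<comment> \<open>As the left-hand side of \<open>T\<close> stays bounded near 0, the pole \<open>(m - 1) / z\<close> on its right-hand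
    side must vanish.\<close>
  have "((\<lambda>z. z * trace (matrix_inv (mat z + (A + ?\<Pi>)))) \<longlongrightarrow> m + 0 * S 0 - 1 / (0 + 1)) (at 0)"
  proof (rule Lim_transform_eventually)
    show "((\<lambda>z. m + z * S z - 1 / (z + 1)) \<longlongrightarrow> m + 0 * S 0 - 1 / (0 + 1)) (at 0)"
      by (intro tendsto_intros S) auto
    show "\<forall>\<^sub>F z in at 0. m + z * S z - 1 / (z + 1) = z * trace (matrix_inv (mat z + (A + ?\<Pi>)))"
      using ev by eventually_elim (subst T, auto simp: divide_simps)
  qed
  moreover have "((\<lambda>z. z * trace (matrix_inv (mat z + (A + ?\<Pi>)))) \<longlongrightarrow> 0 * trace (matrix_inv (A + ?\<Pi>))) (at 0)"
    by (intro tendsto_mult lim tendsto_ident_at)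
  ultimately have "m + 0 * S 0 - 1 / (0 + 1) = 0 * trace (matrix_inv (A + ?\<Pi>))"
    by (rule tendsto_unique[rotated]) simp
  then have m: "m = 1" by simp
  have "((\<lambda>z. trace (matrix_inv (mat z + (A + ?\<Pi>)))) \<longlongrightarrow> 1 / (0 + 1) + S 0) (at 0)"
  proof (rule Lim_transform_eventually)
    show "((\<lambda>z. 1 / (z + 1) + S z) \<longlongrightarrow> 1 / (0 + 1) + S 0) (at 0)"
      by (intro tendsto_intros S) auto
    show "\<forall>\<^sub>F z in at 0. 1 / (z + 1) + S z = trace (matrix_inv (mat z + (A + ?\<Pi>)))"
      using ev by eventually_elim (simp add: T m divide_simps, simp add: algebra_simps)
  qed
  with lim have "trace (matrix_inv (A + ?\<Pi>)) = 1 / (0 + 1) + S 0"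
    by (rule tendsto_unique[rotated]) simp
  then show ?thesis by (simp add: S_def)
qed

section \<open>Finite ergodic semigroups and their generators\<close>

lemma tendsto_matrix_vector_mult:
  fixes A :: "'b \<Rightarrow> 'a::real_normed_field ^ 'n ^ 'm"
  assumes "(A \<longlongrightarrow> B) F"
  shows "((\<lambda>t. A t *v f) \<longlongrightarrow> B *v f) F"
  unfolding matrix_vector_mult_def by (intro tendsto_intros assms)

lemma tendsto_vector_matrix_mult:
  fixes A :: "'b \<Rightarrow> 'a::real_normed_field ^ 'n ^ 'm"
  assumes "(A \<longlongrightarrow> B) F"
  shows "((\<lambda>t. p v* A t) \<longlongrightarrow> p v* B) F"
  unfolding vector_matrix_mult_def by (intro tendsto_intros assms)

lemma stochastic_matrix_mult_one: "stochastic_matrix A \<Longrightarrow> A *v 1 = 1"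
  by (simp add: stochastic_matrix_def matrix_vector_mult_def vec_eq_iff)

lemma stochastic_matrix_contraction:
  assumes "stochastic_matrix A" and "\<And>x. \<bar>f $ x\<bar> \<le> c"
  shows "\<bar>(A *v f) $ x\<bar> \<le> c"
proof -
  have "\<bar>(A *v f) $ x\<bar> \<le> (\<Sum>y\<in>UNIV. \<bar>A $ x $ y * f $ y\<bar>)"
    by (simp add: matrix_vector_mult_def sum_abs)
  also have "\<dots> \<le> (\<Sum>y\<in>UNIV. A $ x $ y * c)"
    using assms by (intro sum_mono) (auto simp: stochastic_matrix_def abs_mult intro!: mult_left_mono)
  also have "\<dots> = c"
    using assms(1) by (simp add: stochastic_matrix_def flip: sum_distrib_right)
  finally show ?thesis .
qed

lemma generator_mult_one:
  assumes "markov_semigroup P" and "has_generator P L"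
  shows "L *v 1 = 0"
proof (rule tendsto_unique)
  show "((\<lambda>t. ((1 / t) *\<^sub>R (P t - mat 1)) *v 1) \<longlongrightarrow> L *v 1) (at_right 0)"
    using assms(2) by (intro tendsto_matrix_vector_mult) (simp add: has_generator_def)
  have "((1 / t) *\<^sub>R (P t - mat 1)) *v 1 = 0" if "t > 0" for t
    using assms(1) that
    by (simp add: markov_semigroup_def stochastic_matrix_mult_one scaleR_matrix_vector_assoc[symmetric]
        matrix_vector_mult_diff_rdistrib)
  then show "((\<lambda>t. ((1 / t) *\<^sub>R (P t - mat 1)) *v 1) \<longlongrightarrow> 0) (at_right 0)"
    by (intro tendsto_eventually eventually_at_rightI[of 0 1]) auto
qed simp

lemma stationary_distribution_mult_generator:
  assumes "stationary_distribution P \<pi>" and "has_generator P L"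
  shows "\<pi> v* L = 0"
proof (rule tendsto_unique)
  show "((\<lambda>t. \<pi> v* ((1 / t) *\<^sub>R (P t - mat 1))) \<longlongrightarrow> \<pi> v* L) (at_right 0)"
    using assms(2) by (intro tendsto_vector_matrix_mult) (simp add: has_generator_def)
  have "\<pi> v* ((1 / t) *\<^sub>R (P t - mat 1)) = (1 / t) *\<^sub>R (\<pi> v* P t - \<pi> v* mat 1)" for t
    by (simp add: vector_matrix_mult_def vec_eq_iff sum_subtractf algebra_simps
        flip: sum_distrib_right sum_divide_distrib)
  then have "\<pi> v* ((1 / t) *\<^sub>R (P t - mat 1)) = 0" if "t > 0" for t
    using assms(1) that by (simp add: stationary_distribution_def)
  then show "((\<lambda>t. \<pi> v* ((1 / t) *\<^sub>R (P t - mat 1))) \<longlongrightarrow> 0) (at_right 0)"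
    by (intro tendsto_eventually eventually_at_rightI[of 0 1]) auto
qed simp

lemma stationary_distribution_pos:
  assumes "markov_semigroup P" and "ergodic P" and st: "stationary_distribution P \<pi>"
  shows "\<pi> $ y > 0"
proof -
  have nn: "\<And>x. 0 \<le> \<pi> $ x" and "(\<Sum>x\<in>UNIV. \<pi> $ x) = 1"
    using st by (auto simp: stationary_distribution_def)
  then obtain x where x: "\<pi> $ x > 0"
    by (metis less_eq_real_def sum.neutral zero_neq_one)
  obtain t where t: "t \<ge> 0" "P t $ x $ y > 0" using \<open>ergodic P\<close> by (auto simp: ergodic_def)
  have P: "0 \<le> P t $ z $ y" for z
    using assms(1) t by (auto simp: markov_semigroup_def stochastic_matrix_def)
  have "0 < \<pi> $ x * P t $ x $ y" using x t by simp
  also have "\<dots> \<le> (\<Sum>z\<in>UNIV. \<pi> $ z * P t $ z $ y)"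
    by (rule member_le_sum) (auto simp: nn P)
  also have "\<dots> = (\<pi> v* P t) $ y" by (simp add: vector_matrix_mult_def mult.commute)
  also have "\<dots> = \<pi> $ y" using st t by (simp add: stationary_distribution_def)
  finally show ?thesis .
qed

text \<open>Cutting \<open>[0, t]\<close> into \<open>n\<close> equal pieces, each piece moves \<open>f\<close> by \<open>o(1 / n)\<close> since \<open>L f = 0\<close>, and the
  kernels applied afterwards are contractions for the supremum norm, so the \<open>n\<close> errors add up
  to \<open>o(1)\<close>. The argument uses the derivative of the semigroup at time 0 only.\<close>

lemma generator_kernel_invariant:
  assumes sg: "markov_semigroup P" and gen: "has_generator P L"
    and Lf: "L *v f = 0" and t: "t \<ge> 0"
  shows "P t *v f = f"
proof -
  have sm: "stochastic_matrix (P s)" if "s \<ge> 0" for s using sg that by (simp add: markov_semigroup_def)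
  have "\<bar>(P t *v f - f) $ x\<bar> \<le> 0 + e" if "e > 0" for e x
  proof -
    define e' where "e' = e / (t + 1)"
    have e': "e' > 0" using that t by (simp add: e'_def)
    have "((\<lambda>s. ((1 / s) *\<^sub>R (P s - mat 1)) *v f) \<longlongrightarrow> 0) (at_right 0)"
      using tendsto_matrix_vector_mult[of _ L "at_right 0" f] gen Lf by (simp add: has_generator_def)
    then have "\<forall>\<^sub>F s in at_right 0. \<forall>x. norm ((((1 / s) *\<^sub>R (P s - mat 1)) *v f) $ x) < e'"
      using e' by (intro eventually_all_finite order_tendstoD(2)[OF tendsto_norm_zero])
        (auto dest: tendsto_vec_nth[where a = 0])
    then obtain b where "b > 0" and
      b: "\<And>s x. 0 < s \<Longrightarrow> s < b \<Longrightarrow> norm ((((1 / s) *\<^sub>R (P s - mat 1)) *v f) $ x) < e'"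
      by (auto simp: eventually_at_right_field)
    have small: "\<bar>(P s *v f - f) $ x\<bar> \<le> e' * s" if "0 < s" "s < b" for s x
    proof -
      have "(((1 / s) *\<^sub>R (P s - mat 1)) *v f) $ x = (P s *v f - f) $ x / s"
        by (simp add: scaleR_matrix_vector_assoc[symmetric] matrix_vector_mult_diff_rdistrib)
      with b[OF that, of x] have "\<bar>(P s *v f - f) $ x\<bar> / s < e'"
        using that by (simp only: real_norm_def abs_divide abs_of_pos)
      with that show ?thesis by (simp only: pos_divide_less_eq less_imp_le)
    qed
    obtain n :: nat where n: "t / b < real n" using reals_Archimedean2 by blast
    define s where "s = t / real (Suc n)"
    have s: "0 \<le> s" "s < b"
      using n t \<open>b > 0\<close> by (auto simp: s_def field_simps)
    have "\<bar>(P (real k * s) *v f - f) $ x\<bar> \<le> real k * (e' * s)" for k x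
    proof (induction k arbitrary: x)
      case 0
      then show ?case using sg by (simp add: markov_semigroup_def)
    next
      case (Suc k)
      have "P (real (Suc k) * s) = P (real k * s) ** P s"
      proof -
        have "real (Suc k) * s = real k * s + s" by (simp add: algebra_simps)
        then show ?thesis using sg s by (simp add: markov_semigroup_def)
      qed
      then have "P (real (Suc k) * s) *v f - f =
          P (real k * s) *v (P s *v f - f) + (P (real k * s) *v f - f)"
        by (simp add: matrix_vector_mul_assoc matrix_vector_mult_diff_distrib)
      moreover have "\<bar>(P s *v f - f) $ z\<bar> \<le> e' * s" for z
        using small[of s z] s sg by (cases "s = 0") (auto simp: markov_semigroup_def)
      then have "\<bar>(P (real k * s) *v (P s *v f - f)) $ x\<bar> \<le> e' * s"
        using s by (intro stochastic_matrix_contraction sm) auto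
      ultimately have "\<bar>(P (real (Suc k) * s) *v f - f) $ x\<bar> \<le> e' * s + real k * (e' * s)"
        using Suc.IH[of x] 
        by (simp only: vector_add_component)
      then show ?case by (simp add: algebra_simps)
    qed
    from this[of "Suc n" x] have "\<bar>(P t *v f - f) $ x\<bar> \<le> e' * t"
      by (simp add: s_def)
    also have "\<dots> \<le> e" using t that by (simp add: e'_def field_simps)
    finally show ?thesis by simp
  qed
  then have "\<bar>(P t *v f - f) $ x\<bar> \<le> 0" for x by (rule field_le_epsilon)
  then show ?thesis by (simp add: vec_eq_iff)
qed

text \<open>The maximum principle: where \<open>f\<close> is maximal, the average \<open>P t f = f\<close> can only be attained if \<open>f\<close> is
  also maximal at every point that is charged, and ergodicity lets \<open>t\<close> be chosen so that any given
  point is charged.\<close>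

lemma ergodic_generator_kernel:
  assumes sg: "markov_semigroup P" and gen: "has_generator P L" and erg: "ergodic P"
    and Lf: "L *v f = 0"
  shows "f $ x = f $ y"
proof -
  have "Max (range (($) f)) \<in> range (($) f)" by (rule Max_in) auto
  then obtain m where "Max (range (($) f)) = f $ m" by (rule imageE)
  then have m: "f $ z \<le> f $ m" for z
    by (metis Max_ge finite finite_imageI rangeI)
  have "f $ y = f $ m" for y
  proof -
    obtain t where t: "t \<ge> 0" "P t $ m $ y > 0" using erg by (auto simp: ergodic_def)
    have sm: "stochastic_matrix (P t)" using sg t by (simp add: markov_semigroup_def)
    have "(\<Sum>z\<in>UNIV. P t $ m $ z * (f $ m - f $ z)) = f $ m - (P t *v f) $ m"
      using sm by (simp add: stochastic_matrix_def matrix_vector_mult_def right_diff_distrib sum_subtractf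
          flip: sum_distrib_right)
    also have "\<dots> = 0" using generator_kernel_invariant[OF sg gen Lf t(1)] by simp
    finally have "P t $ m $ y * (f $ m - f $ y) = 0"
      using sm m by (subst (asm) sum_nonneg_eq_0_iff) (auto simp: stochastic_matrix_def)
    with t show ?thesis by simp
  qed
  then show ?thesis by metis
qed

text \<open>A function in the kernel is first seen to have mean 0, by applying \<open>1 \<pi>\<^sup>T\<close>, then to be harmonic,
  and hence to be a constant of mean 0.\<close>

lemma ergodic_fundamental_invertible:
  assumes sg: "markov_semigroup P" and gen: "has_generator P L" and erg: "ergodic P"
    and st: "stationary_distribution P \<pi>"
  shows "invertible (const_rows \<pi> - L)"
proof -
  have p1: "(\<Sum>x\<in>UNIV. \<pi> $ x) = 1" using st by (simp add: stationary_distribution_def)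
  have \<Pi>f: "const_rows \<pi> *v f = (\<chi> x. \<Sum>y\<in>UNIV. \<pi> $ y * f $ y)" for f
    by (simp add: const_rows_def matrix_vector_mult_def)
  have "f = 0" if f: "(const_rows \<pi> - L) *v f = 0" for f
  proof -
    have "const_rows \<pi> ** (const_rows \<pi> - L) = const_rows \<pi>"
      using const_rows_mult_eq_0[OF stationary_distribution_mult_generator[OF st gen]]
      by (simp add: matrix_diff_ldistrib const_rows_idem[OF p1])
    with f have z: "const_rows \<pi> *v f = 0"
      by (metis matrix_vector_mul_assoc matrix_vector_mult_0_right)
    with f have "L *v f = 0" by (simp add: matrix_vector_mult_diff_rdistrib)
    then have c: "f $ x = f $ y" for x y using ergodic_generator_kernel[OF sg gen erg] by blast
    have "f $ x = 0" for x
    proof -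
      have "(\<Sum>y\<in>UNIV. \<pi> $ y * f $ y) = (\<Sum>y\<in>UNIV. \<pi> $ y * f $ x)"
        by (intro sum.cong refl arg_cong2[where f = "(*)"] c)
      also have "\<dots> = f $ x" using p1 by (simp flip: sum_distrib_right)
      finally show ?thesis using z by (simp add: \<Pi>f vec_eq_iff)
    qed
    then show "f = 0" by (simp add: vec_eq_iff)
  qed
  then show ?thesis by (simp add: invertible_left_inverse matrix_left_invertible_ker)
qed

section \<open>Poisson's equation for mean hitting times\<close>

text \<open>The classical expression of the mean hitting times of \<open>y\<close> through the fundamental matrix \<open>N\<close> and
  the stationary distribution \<open>p\<close>.\<close>

definition target_times :: "real ^ 'x ^ 'x \<Rightarrow> real ^ 'x \<Rightarrow> 'x \<Rightarrow> real ^ 'x" where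
  "target_times N p y = (\<chi> x. (N $ y $ y - N $ x $ y) / p $ y)"

lemma target_times_self: "target_times N p y $ y = 0"
  by (simp add: target_times_def)

text \<open>Both statements come from the identities \<open>A N = 1 - 1 p\<^sup>T\<close> and \<open>p N = p\<close>. They are needed for
  \<open>-L\<close> and also for its difference quotients \<open>(1 - P \<delta>) / \<delta>\<close>, for which the equation below is the
  first-step equation of the chain observed at multiples of \<open>\<delta>\<close>.\<close>

lemma
  fixes A :: "real ^ 'x ^ 'x::finite"
  assumes A1: "A *v 1 = 0" and pA: "p v* A = 0" and p1: "(\<Sum>x\<in>UNIV. p $ x) = 1"
    and p0: "\<And>y. p $ y \<noteq> 0" and inv: "invertible (A + const_rows p)"
  defines "N \<equiv> matrix_inv (A + const_rows p)"
  shows target_times_Poisson: "x \<noteq> y \<Longrightarrow> (A *v target_times N p y) $ x = 1"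
    and sum_target_times: "(\<Sum>x\<in>UNIV. \<Sum>y\<in>UNIV. target_times N p y $ x * p $ x * p $ y) = trace N - 1"
proof -
  have N: "(A + const_rows p) ** N = mat 1" using matrix_inv_inverse(1)[OF inv] by (simp add: N_def)
  have "const_rows p ** (A + const_rows p) = const_rows p"
    by (simp add: matrix_add_ldistrib const_rows_mult_eq_0[OF pA] const_rows_idem[OF p1])
  then have pN: "const_rows p ** N = const_rows p"
    by (metis N matrix_mul_assoc matrix_mul_rid)
  then have pN': "(\<Sum>x\<in>UNIV. N $ x $ y * p $ x) = p $ y" for y
    by (simp add: const_rows_def matrix_matrix_mult_def vec_eq_iff mult.commute)
  show "(A *v target_times N p y) $ x = 1" if "x \<noteq> y"
  proof -
    have "(A ** N) $ x $ y = - p $ y"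
      using N that pN by (simp add: matrix_add_rdistrib)
        (simp add: vec_eq_iff const_rows_def mat_def eq_neg_iff_add_eq_0)
    moreover have "(\<Sum>z\<in>UNIV. A $ x $ z) = 0"
      using A1 by (simp add: vec_eq_iff matrix_vector_mult_def)
    then have "(A *v target_times N p y) $ x = - (A ** N) $ x $ y / p $ y"
      by (simp add: matrix_vector_mult_def target_times_def matrix_matrix_mult_def right_diff_distrib
         sum_subtractf flip: sum_divide_distrib sum_distrib_right)
    ultimately show ?thesis using p0 by simp
  qed
  have "(\<Sum>x\<in>UNIV. \<Sum>y\<in>UNIV. target_times N p y $ x * p $ x * p $ y) =
      (\<Sum>y\<in>UNIV. \<Sum>x\<in>UNIV. N $ y $ y * p $ x - N $ x $ y * p $ x)"
    using p0 by (subst sum.swap) (intro sum.cong, auto simp: target_times_def field_simps)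
  also have "\<dots> = trace N - 1"
    using p1 by (simp add: sum_subtractf pN' trace_def flip: sum_distrib_left)
  finally show "(\<Sum>x\<in>UNIV. \<Sum>y\<in>UNIV. target_times N p y $ x * p $ x * p $ y) = trace N - 1" .
qed

section \<open>The chain observed along a time grid\<close>

definition skeleton_hitting_time :: "(real \<Rightarrow> 'w \<Rightarrow> 'x) \<Rightarrow> real \<Rightarrow> 'x \<Rightarrow> 'w \<Rightarrow> ennreal" where
  "skeleton_hitting_time X \<delta> y \<omega> = (INF k\<in>{k. X (real k * \<delta>) \<omega> = y}. ennreal (real k * \<delta>))"

text \<open>The tail-sum formula for the hitting time. It yields measurability and reduces the expectation to
  the probabilities of avoiding \<open>y\<close> so far.\<close>

lemma skeleton_hitting_time_eq_suminf:
  assumes "\<delta> > 0"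
  shows "skeleton_hitting_time X \<delta> y \<omega> =
    (\<Sum>k. ennreal \<delta> * indicator {\<omega>. \<forall>i\<le>k. X (real i * \<delta>) \<omega> \<noteq> y} \<omega>)"
proof (cases "\<exists>k. X (real k * \<delta>) \<omega> = y")
  case False
  then have "(\<Sum>k. ennreal \<delta> * indicator {\<omega>. \<forall>i\<le>k. X (real i * \<delta>) \<omega> \<noteq> y} \<omega>) = (\<Sum>k::nat. ennreal \<delta>)"
    by (simp add: indicator_def)
  also have "\<dots> = (SUP n. of_nat n * ennreal \<delta>)" unfolding suminf_eq_SUP by simp
  also have "\<dots> = (SUP n. of_nat n) * ennreal \<delta>" by (rule SUP_mult_right_ennreal[symmetric])
  also have "\<dots> = \<infinity>" using assms by (simp add: ennreal_SUP_of_nat_eq_top ennreal_top_mult)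
  also have "\<dots> = skeleton_hitting_time X \<delta> y \<omega>" using False by (simp add: skeleton_hitting_time_def)
  finally show ?thesis by (rule sym)
next
  case True
  define m where "m = (LEAST k. X (real k * \<delta>) \<omega> = y)"
  have m: "X (real m * \<delta>) \<omega> = y" and least: "\<And>k. X (real k * \<delta>) \<omega> = y \<Longrightarrow> m \<le> k"
    using True by (auto simp: m_def intro: LeastI_ex Least_le)
  have "skeleton_hitting_time X \<delta> y \<omega> = ennreal (real m * \<delta>)"
    unfolding skeleton_hitting_time_def
  proof (rule antisym)
    show "(INF k\<in>{k. X (real k * \<delta>) \<omega> = y}. ennreal (real k * \<delta>)) \<le> ennreal (real m * \<delta>)"
      using m by (intro INF_lower) auto
    show "ennreal (real m * \<delta>) \<le> (INF k\<in>{k. X (real k * \<delta>) \<omega> = y}. ennreal (real k * \<delta>))"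
      using least assms by (intro INF_greatest ennreal_leI mult_right_mono) auto
  qed
  moreover have avoided: "(\<forall>i\<le>k. X (real i * \<delta>) \<omega> \<noteq> y) \<longleftrightarrow> k < m" for k
  proof
    show "k < m" if "\<forall>i\<le>k. X (real i * \<delta>) \<omega> \<noteq> y" using that m by (cases "m \<le> k") auto
    show "\<forall>i\<le>k. X (real i * \<delta>) \<omega> \<noteq> y" if "k < m"
    proof (intro allI impI notI)
      fix i assume "i \<le> k" "X (real i * \<delta>) \<omega> = y"
      with least[of i] that show False by simp
    qed
  qed
  have "(\<Sum>k. ennreal \<delta> * indicator {\<omega>. \<forall>i\<le>k. X (real i * \<delta>) \<omega> \<noteq> y} \<omega>) =
      (\<Sum>k<m. ennreal \<delta> * indicator {\<omega>. \<forall>i\<le>k. X (real i * \<delta>) \<omega> \<noteq> y} \<omega>)"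
    by (intro suminf_finite) (auto simp: indicator_def avoided)
  moreover have "\<dots> = (\<Sum>k<m. ennreal \<delta>)"
    by (intro sum.cong) (auto simp: indicator_def avoided)
  moreover have "\<dots> = ennreal (real m * \<delta>)"
    using assms by (simp add: ennreal_mult ennreal_of_nat_eq_real_of_nat)
  ultimately show ?thesis by simp
qed

context
  fixes P :: "real \<Rightarrow> real ^ 'x ^ 'x::finite" and M :: "'x \<Rightarrow> 'w measure"
    and X :: "real \<Rightarrow> 'w \<Rightarrow> 'x"
  assumes mc: "markov_chain P M X"
begin

lemma chain_prob_space: "prob_space (M x)"
  using mc by (simp add: markov_chain_def)

lemma chain_pred_measurable:
  assumes "t \<ge> 0" shows "Measurable.pred (M x) (\<lambda>\<omega>. X t \<omega> = a)"
proof -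
  have "X t \<in> measurable (M x) (count_space UNIV)"
    using mc assms by (simp add: markov_chain_def)
  then show ?thesis by (rule measurable_compose) simp
qed

text \<open>The Markov property conditions on a complete path along the grid. Summing over the finitely many
  paths that avoid \<open>y\<close> and end in \<open>w\<close> gives it for the event that \<open>y\<close> has been avoided.\<close>

lemma chain_avoid_step:
  assumes "\<delta> \<ge> 0"
  shows "measure (M x) {\<omega> \<in> space (M x). (\<forall>i\<le>k. X (real i * \<delta>) \<omega> \<noteq> y) \<and> X (real k * \<delta>) \<omega> = w
        \<and> X (real (Suc k) * \<delta>) \<omega> = z} =
    measure (M x) {\<omega> \<in> space (M x). (\<forall>i\<le>k. X (real i * \<delta>) \<omega> \<noteq> y) \<and> X (real k * \<delta>) \<omega> = w} * P \<delta> $ w $ z"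
proof -
  interpret prob_space "M x" by (rule chain_prob_space)
  define F where "F = {f \<in> {..k} \<rightarrow>\<^sub>E (UNIV :: 'x set). (\<forall>i\<le>k. f i \<noteq> y) \<and> f k = w}"
  have fin: "finite F"
    unfolding F_def by (rule finite_subset[OF _ finite_PiE[of "{..k}" "\<lambda>_. UNIV :: 'x set"]]) auto
  have path: "restrict (\<lambda>i. X (real i * \<delta>) \<omega>) {..k} \<in> F"
    if "\<forall>i\<le>k. X (real i * \<delta>) \<omega> \<noteq> y" "X (real k * \<delta>) \<omega> = w" for \<omega>
    using that by (auto simp: F_def)
  have [measurable]: "Measurable.pred (M x) (\<lambda>\<omega>. X (real i * \<delta>) \<omega> = a)" for i a
    using assms by (intro chain_pred_measurable) simp
  have dec: "measure (M x) {\<omega> \<in> space (M x). (\<forall>i\<le>k. X (real i * \<delta>) \<omega> \<noteq> y) \<and> X (real k * \<delta>) \<omega> = w \<and> R \<omega>} =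
      (\<Sum>f\<in>F. measure (M x) {\<omega> \<in> space (M x). (\<forall>i\<le>k. X (real i * \<delta>) \<omega> = f i) \<and> R \<omega>})"
    if [measurable]: "Measurable.pred (M x) R" for R
  proof -
    have "{\<omega> \<in> space (M x). (\<forall>i\<le>k. X (real i * \<delta>) \<omega> \<noteq> y) \<and> X (real k * \<delta>) \<omega> = w \<and> R \<omega>} =
        (\<Union>f\<in>F. {\<omega> \<in> space (M x). (\<forall>i\<le>k. X (real i * \<delta>) \<omega> = f i) \<and> R \<omega>})" (is "?A = ?B")
    proof
      show "?A \<subseteq> ?B"
        by (intro subsetI UN_I[OF path]) auto
      show "?B \<subseteq> ?A" by (auto simp: F_def)
    qed
    also have "measure (M x) \<dots> = (\<Sum>f\<in>F. measure (M x) {\<omega> \<in> space (M x). (\<forall>i\<le>k. X (real i * \<delta>) \<omega> = f i) \<and> R \<omega>})"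
    proof (rule finite_measure_finite_Union[OF fin])
      show "(\<lambda>f. {\<omega> \<in> space (M x). (\<forall>i\<le>k. X (real i * \<delta>) \<omega> = f i) \<and> R \<omega>}) ` F \<subseteq> events"
        by auto
      have "f = g" if "f \<in> F" "g \<in> F" "\<forall>i\<le>k. X (real i * \<delta>) \<omega> = f i" "\<forall>i\<le>k. X (real i * \<delta>) \<omega> = g i" for f g \<omega>
        by (rule PiE_ext[of f "{..k}" "\<lambda>_. UNIV" g]) (use that in \<open>auto simp: F_def\<close>)
      then show "disjoint_family_on (\<lambda>f. {\<omega> \<in> space (M x). (\<forall>i\<le>k. X (real i * \<delta>) \<omega> = f i) \<and> R \<omega>}) F"
        unfolding disjoint_family_on_def by blast
    qed
    finally show ?thesis .
  qed
  have step: "measure (M x) {\<omega> \<in> space (M x). (\<forall>i\<le>k. X (real i * \<delta>) \<omega> = f i) \<and> X (real (Suc k) * \<delta>) \<omega> = z} =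
      measure (M x) {\<omega> \<in> space (M x). \<forall>i\<le>k. X (real i * \<delta>) \<omega> = f i} * P \<delta> $ w $ z" if "f \<in> F" for f
  proof -
    have "measure (M x) {\<omega> \<in> space (M x). (\<forall>i\<le>k. X (real i * \<delta>) \<omega> = f i) \<and> X (real k * \<delta> + \<delta>) \<omega> = z} =
        measure (M x) {\<omega> \<in> space (M x). \<forall>i\<le>k. X (real i * \<delta>) \<omega> = f i} * P \<delta> $ f k $ z"
      using mc[unfolded markov_chain_def, rule_format, THEN conjunct2, THEN conjunct2, THEN conjunct2, THEN conjunct2,
        rule_format, of "\<lambda>i. real i * \<delta>" k \<delta> x f z] assms
      by (simp add: mult_right_mono)
    then show ?thesis using that by (simp add: F_def algebra_simps)
  qed
  show ?thesis
    using dec[of "\<lambda>\<omega>. X (real (Suc k) * \<delta>) \<omega> = z"] dec[of "\<lambda>_. True"] step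
    by (simp add: sum_distrib_right del: of_nat_Suc)
qed

text \<open>Optional stopping in terms of masses. Let \<open>v k\<close> be the law at step \<open>k\<close> of the chain killed at \<open>y\<close>,
  with total mass \<open>S k\<close>. The equation for \<open>h\<close> says that pairing \<open>v k\<close> with \<open>h\<close> decreases by
  \<open>\<delta> S k\<close> in each step. As \<open>h\<close> is bounded the sum of the \<open>\<delta> S k\<close> converges, so \<open>S k\<close>, and with it the
  pairing, tends to 0; the sum, which is the mean hitting time, therefore equals the initial
  value \<open>h x\<close>.\<close>

lemma skeleton_expectation:
  assumes \<delta>: "\<delta> > 0" and hy: "h $ y = 0"
    and h: "\<And>z. z \<noteq> y \<Longrightarrow> h $ z = \<delta> + (P \<delta> *v h) $ z"
  shows "(\<integral>\<^sup>+\<omega>. skeleton_hitting_time X \<delta> y \<omega> \<partial>M x) = ennreal (h $ x)" and "0 \<le> h $ x"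
proof -
  interpret prob_space "M x" by (rule chain_prob_space)
  have [measurable]: "Measurable.pred (M x) (\<lambda>\<omega>. X (real i * \<delta>) \<omega> = a)" for i a
    using \<delta> by (intro chain_pred_measurable) simp
  define v where "v k z = prob {\<omega> \<in> space (M x). (\<forall>i\<le>k. X (real i * \<delta>) \<omega> \<noteq> y) \<and> X (real k * \<delta>) \<omega> = z}" for k z
  define S where "S k = prob {\<omega> \<in> space (M x). \<forall>i\<le>k. X (real i * \<delta>) \<omega> \<noteq> y}" for k
  have split: "prob {\<omega> \<in> space (M x). R \<omega>} = (\<Sum>w\<in>UNIV. prob {\<omega> \<in> space (M x). R \<omega> \<and> X (real k * \<delta>) \<omega> = w})"
    if [measurable]: "Measurable.pred (M x) R" for R k
  proof -
    have "{\<omega> \<in> space (M x). R \<omega>} = (\<Union>w\<in>UNIV. {\<omega> \<in> space (M x). R \<omega> \<and> X (real k * \<delta>) \<omega> = w})" by auto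
    also have "prob \<dots> = (\<Sum>w\<in>UNIV. prob {\<omega> \<in> space (M x). R \<omega> \<and> X (real k * \<delta>) \<omega> = w})"
      by (rule finite_measure_finite_Union) (auto simp: disjoint_family_on_def)
    finally show ?thesis .
  qed
  have S: "S k = (\<Sum>z\<in>UNIV. v k z)" for k
    unfolding S_def v_def by (rule split) measurable
  have vy: "v k y = 0" for k
  proof -
    have "{\<omega> \<in> space (M x). (\<forall>i\<le>k. X (real i * \<delta>) \<omega> \<noteq> y) \<and> X (real k * \<delta>) \<omega> = y} = {}" by auto
    then show ?thesis unfolding v_def by (simp only: measure_empty)
  qed
  have v_Suc: "v (Suc k) z = (\<Sum>w\<in>UNIV. v k w * P \<delta> $ w $ z)" if "z \<noteq> y" for k z
  proof -
    have "v (Suc k) z = prob {\<omega> \<in> space (M x). (\<forall>i\<le>k. X (real i * \<delta>) \<omega> \<noteq> y) \<and> X (real (Suc k) * \<delta>) \<omega> = z}"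
      unfolding v_def using that by (intro arg_cong[where f = prob]) (auto simp: le_Suc_eq)
    also have "\<dots> = (\<Sum>w\<in>UNIV. prob {\<omega> \<in> space (M x). ((\<forall>i\<le>k. X (real i * \<delta>) \<omega> \<noteq> y) \<and>
        X (real (Suc k) * \<delta>) \<omega> = z) \<and> X (real k * \<delta>) \<omega> = w})"
      by (rule split) measurable
    also have "\<dots> = (\<Sum>w\<in>UNIV. v k w * P \<delta> $ w $ z)"
      unfolding v_def using \<delta> by (subst chain_avoid_step[symmetric]) (auto intro!: sum.cong arg_cong[where f = prob])
    finally show ?thesis .
  qed
  have v0: "v 0 z = (if z = x \<and> x \<noteq> y then 1 else 0)" for z
  proof -
    have [measurable]: "Measurable.pred (M x) (\<lambda>\<omega>. X 0 \<omega> = a)" for a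
      by (intro chain_pred_measurable) simp
    have "AE \<omega> in M x. X 0 \<omega> = x" using mc by (simp add: markov_chain_def)
    then have "v 0 z = prob {\<omega> \<in> space (M x). z = x \<and> x \<noteq> y}"
      unfolding v_def by (intro measure_eq_AE) auto
    then show ?thesis by (cases "z = x \<and> x \<noteq> y") (auto simp: prob_space)
  qed
  have vnn: "0 \<le> v k z" for k z by (simp add: v_def)
  define \<phi> where "\<phi> k = (\<Sum>z\<in>UNIV. v k z * h $ z)" for k
  have \<phi>0: "\<phi> 0 = h $ x"
    unfolding \<phi>_def v0 using hy by (cases "x = y") (simp_all add: if_distrib[of "\<lambda>a. a * _"] cong: if_cong)
  have \<phi>_Suc: "\<phi> (Suc k) = \<phi> k - \<delta> * S k" for k
  proof -
    have "\<phi> (Suc k) = (\<Sum>z\<in>UNIV. (\<Sum>w\<in>UNIV. v k w * P \<delta> $ w $ z) * h $ z)"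
      unfolding \<phi>_def
    proof (intro sum.cong refl)
      fix z show "v (Suc k) z * h $ z = (\<Sum>w\<in>UNIV. v k w * P \<delta> $ w $ z) * h $ z"
        using v_Suc[of z k] hy by (cases "z = y") auto
    qed
    also have "\<dots> = (\<Sum>w\<in>UNIV. v k w * (P \<delta> *v h) $ w)"
      by (simp add: sum_distrib_right sum_distrib_left matrix_vector_mult_def mult.assoc) (rule sum.swap)
    also have "\<dots> = (\<Sum>w\<in>UNIV. v k w * (h $ w - \<delta>))"
    proof (intro sum.cong refl)
      fix w show "v k w * (P \<delta> *v h) $ w = v k w * (h $ w - \<delta>)"
        using h[of w] vy by (cases "w = y") auto
    qed
    finally show ?thesis
      by (simp add: \<phi>_def S right_diff_distrib sum_subtractf sum_distrib_left mult.commute)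
  qed
  have partial: "(\<Sum>k<n. \<delta> * S k) = h $ x - \<phi> n" for n
    by (induction n) (auto simp: \<phi>0 \<phi>_Suc)
  define C where "C = (\<Sum>z\<in>UNIV. \<bar>h $ z\<bar>)"
  have \<phi>_le: "\<bar>\<phi> n\<bar> \<le> S n * C" for n
  proof -
    have "\<bar>\<phi> n\<bar> \<le> (\<Sum>z\<in>UNIV. \<bar>v n z * h $ z\<bar>)" unfolding \<phi>_def by (rule sum_abs)
    also have "\<dots> \<le> (\<Sum>z\<in>UNIV. v n z * C)"
      using vnn by (intro sum_mono) (auto simp: abs_mult C_def intro!: mult_left_mono member_le_sum)
    finally show ?thesis by (simp add: S sum_distrib_right)
  qed
  have Snn: "0 \<le> S k" and S1: "S k \<le> 1" for k by (simp_all add: S_def)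
  have C: "0 \<le> C" by (simp add: C_def sum_nonneg)
  have "summable (\<lambda>k. \<delta> * S k)"
  proof (rule bounded_imp_summable)
    show "(\<Sum>k\<le>n. \<delta> * S k) \<le> h $ x + C" for n
    proof -
      have "\<bar>\<phi> (Suc n)\<bar> \<le> C"
        using \<phi>_le[of "Suc n"] mult_right_mono[OF S1[of "Suc n"] C] by simp
      then show ?thesis using partial[of "Suc n"] by (simp add: lessThan_Suc_atMost)
    qed
  qed (use \<delta> Snn in auto)
  then have "(\<lambda>k. inverse \<delta> * (\<delta> * S k)) \<longlonglongrightarrow> inverse \<delta> * 0"
    by (intro tendsto_mult tendsto_const summable_LIMSEQ_zero)
  then have "(\<lambda>n. S n * C) \<longlonglongrightarrow> 0 * C"
    using \<delta> by (intro tendsto_mult tendsto_const) simp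
  then have SC: "(\<lambda>n. S n * C) \<longlonglongrightarrow> 0" by simp
  have "\<phi> \<longlonglongrightarrow> 0"
  proof (rule Lim_null_comparison[OF _ SC])
    show "\<forall>\<^sub>F n in sequentially. norm (\<phi> n) \<le> S n * C"
      unfolding real_norm_def by (rule always_eventually[OF allI, OF \<phi>_le])
  qed
  then have "(\<lambda>n. h $ x - \<phi> n) \<longlonglongrightarrow> h $ x - 0" by (intro tendsto_intros)
  then have sums: "(\<lambda>k. \<delta> * S k) sums h $ x" by (simp add: sums_def partial)
  show "0 \<le> h $ x" by (rule sums_le[OF _ sums_zero sums]) (use \<delta> Snn in simp)
  have "(\<integral>\<^sup>+\<omega>. skeleton_hitting_time X \<delta> y \<omega> \<partial>M x) =
      (\<integral>\<^sup>+\<omega>. (\<Sum>k. ennreal \<delta> * indicator {\<omega> \<in> space (M x). \<forall>i\<le>k. X (real i * \<delta>) \<omega> \<noteq> y} \<omega>) \<partial>M x)"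
    unfolding skeleton_hitting_time_eq_suminf[OF \<delta>]
    by (intro nn_integral_cong suminf_cong) (auto simp: indicator_def)
  also have "\<dots> = (\<Sum>k. \<integral>\<^sup>+\<omega>. ennreal \<delta> * indicator {\<omega> \<in> space (M x). \<forall>i\<le>k. X (real i * \<delta>) \<omega> \<noteq> y} \<omega> \<partial>M x)"
    by (intro nn_integral_suminf) measurable
  also have "\<dots> = (\<Sum>k. ennreal (\<delta> * S k))"
    using \<delta> by (intro suminf_cong) (simp add: nn_integral_cmult_indicator emeasure_eq_measure S_def ennreal_mult)
  also have "\<dots> = ennreal (h $ x)"
    by (rule suminf_ennreal_eq[OF _ sums]) (use \<delta> Snn in simp)
  finally show "(\<integral>\<^sup>+\<omega>. skeleton_hitting_time X \<delta> y \<omega> \<partial>M x) = ennreal (h $ x)" .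
qed

lemma measurable_skeleton_hitting_time:
  assumes "\<delta> > 0"
  shows "skeleton_hitting_time X \<delta> y \<in> borel_measurable (M x)"
proof -
  have [measurable]: "Measurable.pred (M x) (\<lambda>\<omega>. X (real i * \<delta>) \<omega> = a)" for i a
    using assms by (intro chain_pred_measurable) simp
  have "(\<lambda>\<omega>. \<Sum>k. ennreal \<delta> * indicator {\<omega> \<in> space (M x). \<forall>i\<le>k. X (real i * \<delta>) \<omega> \<noteq> y} \<omega>) \<in> borel_measurable (M x)"
    by measurable
  moreover have "skeleton_hitting_time X \<delta> y \<omega> =
      (\<Sum>k. ennreal \<delta> * indicator {\<omega> \<in> space (M x). \<forall>i\<le>k. X (real i * \<delta>) \<omega> \<noteq> y} \<omega>)" if "\<omega> \<in> space (M x)" for \<omega>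
    unfolding skeleton_hitting_time_eq_suminf[OF assms]
    using that by (intro suminf_cong) (auto simp: indicator_def)
  ultimately show ?thesis by (subst measurable_cong) auto
qed

end

section \<open>From the grids to continuous time\<close>

text \<open>If a right-continuous path is in \<open>y\<close> at time \<open>t\<close>, it remains there for a while, and so it is in \<open>y\<close> at
  some dyadic time shortly after \<open>t\<close>. The offset \<open>n0\<close> allows the coarsest grids to be discarded.\<close>

lemma hitting_time_eq_INF_dyadic:
  assumes rc: "\<And>t. t \<ge> 0 \<Longrightarrow> \<forall>\<^sub>F s in at_right t. X s \<omega> = X t \<omega>"
  shows "hitting_time X y \<omega> = (INF n. skeleton_hitting_time X ((1/2) ^ (n + n0)) y \<omega>)"
proof (rule antisym)
  show "hitting_time X y \<omega> \<le> (INF n. skeleton_hitting_time X ((1/2) ^ (n + n0)) y \<omega>)"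
    unfolding hitting_time_def skeleton_hitting_time_def
    by (intro INF_greatest INF_lower) auto
  show "(INF n. skeleton_hitting_time X ((1/2) ^ (n + n0)) y \<omega>) \<le> hitting_time X y \<omega>"
    unfolding hitting_time_def
  proof (rule INF_greatest)
    fix t assume t: "t \<in> {t. 0 \<le> t \<and> X t \<omega> = y}"
    show "(INF n. skeleton_hitting_time X ((1/2) ^ (n + n0)) y \<omega>) \<le> ennreal t"
    proof (rule ennreal_le_epsilon)
      fix e :: real assume e: "e > 0"
      obtain b where b: "b > t" "\<And>s. t < s \<Longrightarrow> s < b \<Longrightarrow> X s \<omega> = y"
        using rc[of t] t by (auto simp: eventually_at_right_field)
      obtain n where n: "(1/2) ^ n < b - t" "(1/2) ^ n < e"
        using real_arch_pow_inv[of "min (b - t) e" "1/2"] b e by auto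
      define \<delta> :: real where "\<delta> = (1/2) ^ (n + n0)"
      have "\<delta> \<le> (1/2) ^ n" unfolding \<delta>_def by (intro power_decreasing) auto
      with n have \<delta>: "\<delta> < b - t" "\<delta> < e" by simp_all
      have "0 < \<delta>" by (simp add: \<delta>_def)
      note \<delta> = this \<delta>
      define k where "k = nat (\<lfloor>t / \<delta>\<rfloor> + 1)"
      have "real k = of_int \<lfloor>t / \<delta>\<rfloor> + 1" using t \<delta> by (simp add: k_def)
      then have "t / \<delta> < real k" "real k \<le> t / \<delta> + 1" by linarith+
      then have k: "t < real k * \<delta>" "real k * \<delta> \<le> t + \<delta>"
        using \<delta> by (simp_all add: field_simps)
      then have "X (real k * \<delta>) \<omega> = y" using b \<delta> by simp
      then have "skeleton_hitting_time X \<delta> y \<omega> \<le> ennreal (real k * \<delta>)"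
        unfolding skeleton_hitting_time_def by (intro INF_lower) auto
      also have "\<dots> \<le> ennreal t + ennreal e"
        using k \<delta> t by (simp flip: ennreal_plus)
      finally show "(INF n. skeleton_hitting_time X ((1/2) ^ (n + n0)) y \<omega>) \<le> ennreal t + ennreal e"
        unfolding \<delta>_def by (rule INF_lower2[rotated]) simp
    qed
  qed
qed

lemma skeleton_hitting_time_half_le:
  "skeleton_hitting_time X (\<delta> / 2) y \<omega> \<le> skeleton_hitting_time X \<delta> y \<omega>"
  unfolding skeleton_hitting_time_def
proof (rule INF_mono)
  fix k assume "k \<in> {k. X (real k * \<delta>) \<omega> = y}"
  then show "\<exists>j\<in>{k. X (real k * (\<delta> / 2)) \<omega> = y}. ennreal (real j * (\<delta> / 2)) \<le> ennreal (real k * \<delta>)"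
    by (intro bexI[of _ "2 * k"]) auto
qed

text \<open>The mean hitting times of the dyadic skeletons are given by the same formula, with the difference
  quotient \<open>A n\<close> in place of \<open>-L\<close>. Since \<open>1 \<pi>\<^sup>T - L\<close> is invertible, so is \<open>A n + 1 \<pi>\<^sup>T\<close> on all fine grids,
  and the inverses converge. On the side of the probabilities the skeleton hitting times decrease
  to the hitting time, and monotone convergence applies because their expectations are finite from
  \<open>n0\<close> on.\<close>

proposition expected_hitting_time_eq:
  fixes P :: "real \<Rightarrow> real ^ 'x ^ 'x::finite"
  assumes sg: "markov_semigroup P" and gen: "has_generator P L" and mc: "markov_chain P M X"
    and erg: "ergodic P" and st: "stationary_distribution P \<pi>"
  defines "N \<equiv> matrix_inv (const_rows \<pi> - L)"
  shows "expected_hitting_time M X x y = ennreal (target_times N \<pi> y $ x)"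
    and "0 \<le> target_times N \<pi> y $ x"
proof -
  define \<delta> :: "nat \<Rightarrow> real" where "\<delta> n = (1/2) ^ n" for n
  have \<delta>: "\<delta> n > 0" for n by (simp add: \<delta>_def)
  define A where "A n = (1 / \<delta> n) *\<^sub>R (mat 1 - P (\<delta> n))" for n
  define h where "h n = target_times (matrix_inv (A n + const_rows \<pi>)) \<pi> y" for n
  have \<pi>: "(\<Sum>x\<in>UNIV. \<pi> $ x) = 1" "\<And>x. \<pi> $ x > 0"
    using st stationary_distribution_pos[OF sg erg st] by (auto simp: stationary_distribution_def)
  have sm: "stochastic_matrix (P (\<delta> n))" for n
    using sg \<delta>[of n] by (simp add: markov_semigroup_def)
  have "filterlim \<delta> (at_right 0) sequentially"
    unfolding filterlim_at using \<delta> by (auto simp: \<delta>_def[abs_def] intro!: LIMSEQ_realpow_zero)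
  then have "(\<lambda>n. (1 / \<delta> n) *\<^sub>R (P (\<delta> n) - mat 1)) \<longlonglongrightarrow> L"
    using gen unfolding has_generator_def by (rule filterlim_compose[rotated])
  moreover have "A n = - ((1 / \<delta> n) *\<^sub>R (P (\<delta> n) - mat 1))" for n
    by (simp add: A_def flip: scaleR_minus_right)
  ultimately have "(\<lambda>n. A n + const_rows \<pi>) \<longlonglongrightarrow> - L + const_rows \<pi>"
    by (simp only:) (intro tendsto_add tendsto_minus tendsto_const)
  then have lim: "(\<lambda>n. A n + const_rows \<pi>) \<longlonglongrightarrow> const_rows \<pi> - L" by simp
  note inv = ergodic_fundamental_invertible[OF sg gen erg st]
  have h_lim: "(\<lambda>n. h n $ x) \<longlonglongrightarrow> target_times N \<pi> y $ x"
    using \<pi>(2)[of y] unfolding h_def N_def target_times_def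
    by (simp, intro tendsto_intros tendsto_matrix_inv lim inv) simp
  obtain n0 where n0: "\<And>n. n \<ge> n0 \<Longrightarrow> invertible (A n + const_rows \<pi>)"
    using eventually_invertible[OF lim inv] by (auto simp: eventually_sequentially)
  have E: "(\<integral>\<^sup>+\<omega>. skeleton_hitting_time X (\<delta> n) y \<omega> \<partial>M x) = ennreal (h n $ x)" "0 \<le> h n $ x" if "n \<ge> n0" for n
  proof -
    have Av: "A n *v f = (1 / \<delta> n) *\<^sub>R (f - P (\<delta> n) *v f)" for f
      by (simp add: A_def scaleR_matrix_vector_assoc[symmetric] matrix_vector_mult_diff_rdistrib)
    have "h n $ z = \<delta> n + (P (\<delta> n) *v h n) $ z" if "z \<noteq> y" for z
    proof -
      have "(A n *v h n) $ z = 1"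
        unfolding h_def
      proof (rule target_times_Poisson)
        show "A n *v 1 = 0" by (simp add: Av stochastic_matrix_mult_one[OF sm])
        have "\<pi> v* A n = (1 / \<delta> n) *\<^sub>R (\<pi> v* mat 1 - \<pi> v* P (\<delta> n))"
          by (simp add: A_def vector_matrix_mult_def vec_eq_iff sum_subtractf algebra_simps
              flip: sum_distrib_right sum_divide_distrib)
        then show "\<pi> v* A n = 0" using st \<delta>[of n] by (simp add: stationary_distribution_def)
      qed (use \<pi> n0[OF \<open>n \<ge> n0\<close>] that in \<open>auto simp: less_imp_neq[symmetric]\<close>)
      then show ?thesis using \<delta>[of n] by (simp add: Av field_simps)
    qed
    then show "(\<integral>\<^sup>+\<omega>. skeleton_hitting_time X (\<delta> n) y \<omega> \<partial>M x) = ennreal (h n $ x)" "0 \<le> h n $ x"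
      using skeleton_expectation[OF mc \<delta>, of "h n" y n] by (auto simp: h_def target_times_self)
  qed
  show "0 \<le> target_times N \<pi> y $ x"
    using E(2) by (intro LIMSEQ_le_const[OF h_lim]) blast
  let ?D = "\<lambda>n \<omega>. skeleton_hitting_time X (\<delta> (n + n0)) y \<omega>"
  have dec: "?D (Suc n) \<omega> \<le> ?D n \<omega>" for n \<omega>
    using skeleton_hitting_time_half_le[of X "\<delta> (n + n0)" y \<omega>] by (simp add: \<delta>_def)
  have "AE \<omega> in M x. hitting_time X y \<omega> = (INF n. ?D n \<omega>)"
  proof -
    have "AE \<omega> in M x. \<forall>t\<ge>0. \<forall>\<^sub>F s in at_right t. X s \<omega> = X t \<omega>"
      using mc by (simp add: markov_chain_def)
    then show ?thesis
      unfolding \<delta>_def by eventually_elim (rule hitting_time_eq_INF_dyadic, simp)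
  qed
  then have "expected_hitting_time M X x y = (\<integral>\<^sup>+\<omega>. (INF n. ?D n \<omega>) \<partial>M x)"
    unfolding expected_hitting_time_def by (rule nn_integral_cong_AE)
  also have "\<dots> = (INF n. \<integral>\<^sup>+\<omega>. ?D n \<omega> \<partial>M x)"
    using dec E(1)[of n0]
    by (intro nn_integral_monotone_convergence_INF_AE'[where f = ?D] measurable_skeleton_hitting_time[OF mc] \<delta>) auto
  also have "\<dots> = ennreal (target_times N \<pi> y $ x)"
  proof (rule LIMSEQ_unique)
    show "(\<lambda>n. \<integral>\<^sup>+\<omega>. ?D n \<omega> \<partial>M x) \<longlonglongrightarrow> (INF n. \<integral>\<^sup>+\<omega>. ?D n \<omega> \<partial>M x)"
      by (intro LIMSEQ_INF decseq_SucI nn_integral_mono dec)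
    show "(\<lambda>n. \<integral>\<^sup>+\<omega>. ?D n \<omega> \<partial>M x) \<longlonglongrightarrow> ennreal (target_times N \<pi> y $ x)"
      using LIMSEQ_ignore_initial_segment[OF h_lim, of n0]
      by (simp add: E(1))
  qed
  finally show "expected_hitting_time M X x y = ennreal (target_times N \<pi> y $ x)" .
qed

section \<open>The random target identity\<close>

lemma similar_generators_charpoly:
  assumes "similar_generators p q G L"
  shows "det (mat z - complexify L) = det (mat z - complexify G)"
proof -
  obtain \<Lambda> where lin: "Vector_Spaces.linear vector_scalar_mult vector_scalar_mult \<Lambda>" and bij: "bij \<Lambda>"
    and comm: "\<And>f. complexify L *v \<Lambda> f = \<Lambda> (complexify G *v f)"
    using assms by (auto simp: similar_generators_def l2_bounded_operator_def)
  define B where "B = matrix \<Lambda>"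
  have B: "\<Lambda> f = B *v f" for f using matrix_works[OF lin] by (simp add: B_def)
  have "inj ((*v) B)" using bij by (auto simp: bij_def inj_def B)
  then have det: "det B \<noteq> 0"
    by (simp add: invertible_det_nz[symmetric] invertible_left_inverse matrix_left_invertible_injective)
  have "complexify L ** B = B ** complexify G"
    using comm by (simp add: B matrix_vector_mul_assoc matrix_eq)
  moreover have "mat z ** B = B ** mat z"
    by (simp add: mat_commute)
  ultimately have "(mat z - complexify L) ** B = B ** (mat z - complexify G)"
    by (simp add: matrix_diff_ldistrib matrix_diff_rdistrib)
  then have "det (mat z - complexify L) * det B = det B * det (mat z - complexify G)"
    by (metis det_mul)
  with det show ?thesis by simp
qed

lemma complexify_matrix_inv:
  fixes A :: "real ^ 'n ^ 'n"
  assumes "invertible A"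
  shows "invertible (complexify A)" and "matrix_inv (complexify A) = complexify (matrix_inv A)"
proof -
  have "complexify A ** complexify (matrix_inv A) = complexify (A ** matrix_inv A)"
    by (simp add: vec_eq_iff matrix_matrix_mult_def)
  also have "\<dots> = mat 1"
    by (simp add: matrix_inv_inverse[OF assms]) (simp add: vec_eq_iff mat_def)
  finally have "complexify A ** complexify (matrix_inv A) = mat 1" .
  from matrix_inv_unique[OF this]
  show "invertible (complexify A)" and "matrix_inv (complexify A) = complexify (matrix_inv A)" by auto
qed

text \<open>The weighted sum of the mean hitting times is \<open>tr N - 1\<close>, which \<open>trace_inverse_fundamental\<close> evaluates from
  the characteristic polynomial.\<close>

theorem random_target_identity:
  fixes P :: "real \<Rightarrow> real ^ 'x ^ 'x::finite"
  assumes sg: "markov_semigroup P" and gen: "has_generator P L" and mc: "markov_chain P M X"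
    and erg: "ergodic P" and st: "stationary_distribution P \<pi>"
    and eig: "lists_eigenvalues L (\<lambda>i. - c i)"
  obtains s where "s \<ge> 0"
    and "(\<Sum>x\<in>UNIV. \<Sum>y\<in>UNIV. expected_hitting_time M X x y * ennreal (\<pi> $ x) * ennreal (\<pi> $ y)) = ennreal s"
    and "complex_of_real s = (\<Sum>i | i \<in> {1..CARD('x)} \<and> c i \<noteq> 0. 1 / c i)"
proof
  define N where "N = matrix_inv (const_rows \<pi> - L)"
  have \<pi>: "(\<Sum>x\<in>UNIV. \<pi> $ x) = 1" "\<And>x. \<pi> $ x > 0"
    using st stationary_distribution_pos[OF sg erg st] by (auto simp: stationary_distribution_def)
  note L1 = generator_mult_one[OF sg gen] and \<pi>L = stationary_distribution_mult_generator[OF st gen]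
  note inv = ergodic_fundamental_invertible[OF sg gen erg st]
  note E = expected_hitting_time_eq[OF sg gen mc erg st, folded N_def]
  let ?s = "\<Sum>x\<in>UNIV. \<Sum>y\<in>UNIV. target_times N \<pi> y $ x * \<pi> $ x * \<pi> $ y"
  show "?s \<ge> 0" using E(2) \<pi>(2) by (intro sum_nonneg mult_nonneg_nonneg) (auto simp: less_imp_le)
  show "(\<Sum>x\<in>UNIV. \<Sum>y\<in>UNIV. expected_hitting_time M X x y * ennreal (\<pi> $ x) * ennreal (\<pi> $ y)) = ennreal ?s"
    using E(2) \<pi>(2) by (simp add: E(1) sum_nonneg less_imp_le flip: ennreal_mult sum_ennreal)
  have "- L *v 1 = 0" "\<pi> v* - L = 0"
    using L1 \<pi>L by (simp_all add: vec_eq_iff matrix_vector_mult_def vector_matrix_mult_def sum_negf)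
  then have "?s = trace N - 1"
    unfolding N_def using sum_target_times[of "- L" \<pi>] \<pi> inv by (simp add: less_imp_neq[symmetric])
  also have "complex_of_real \<dots> = trace (complexify N) - 1" by (simp add: trace_def)
  also have "\<dots> = (\<Sum>i | i \<in> {1..CARD('x)} \<and> c i \<noteq> 0. 1 / c i)"
  proof -
    let ?A = "- complexify L" and ?p = "\<chi> x. complex_of_real (\<pi> $ x)"
    have *: "complexify (const_rows \<pi> - L) = ?A + const_rows ?p"
      by (simp add: vec_eq_iff const_rows_def)
    have "trace (matrix_inv (?A + const_rows ?p)) = 1 + (\<Sum>i | i \<in> {1..CARD('x)} \<and> c i \<noteq> 0. 1 / c i)"
    proof (rule trace_inverse_fundamental)
      have "(?A *v 1) $ x = - complex_of_real ((L *v 1) $ x)" for x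
        by (simp add: matrix_vector_mult_def sum_negf)
      then show "?A *v 1 = 0" by (simp add: L1 vec_eq_iff)
      have "(?p v* ?A) $ x = - complex_of_real ((\<pi> v* L) $ x)" for x
        by (simp add: vector_matrix_mult_def sum_negf)
      then show "?p v* ?A = 0" by (simp add: \<pi>L vec_eq_iff)
      show "(\<Sum>x\<in>UNIV. ?p $ x) = 1" using \<pi>(1) by (simp flip: of_real_sum)
      show "invertible (?A + const_rows ?p)"
        using complexify_matrix_inv(1)[OF inv] by (simp add: *)
      show "det (mat z + ?A) = (\<Prod>i\<in>{1..CARD('x)}. z + c i)" for z
        using eig by (simp add: lists_eigenvalues_def)
    qed simp
    then show ?thesis
      using complexify_matrix_inv(2)[OF inv] by (simp add: N_def *)
  qed
  finally show "complex_of_real ?s = (\<Sum>i | i \<in> {1..CARD('x)} \<and> c i \<noteq> 0. 1 / c i)" .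
qed

theorem corollary2p3:
  fixes Q P :: "real \<Rightarrow> real ^ 'x ^ 'x::finite"
    and G L :: "real ^ 'x ^ 'x"
    and \<pi>\<^sub>Q \<pi> :: "real ^ 'x"
    and MQ :: "'x \<Rightarrow> 'w measure" and X :: "real \<Rightarrow> 'w \<Rightarrow> 'x"
    and MP :: "'x \<Rightarrow> 'v measure" and Y :: "real \<Rightarrow> 'v \<Rightarrow> 'x"
    and eig :: "nat \<Rightarrow> complex"
  assumes "markov_semigroup Q" and "has_generator Q G" and "markov_chain Q MQ X"
    and "ergodic Q" and "stationary_distribution Q \<pi>\<^sub>Q"
    and "markov_semigroup P" and "has_generator P L" and "markov_chain P MP Y"
    and "ergodic P" and "stationary_distribution P \<pi>"
    and "similar_generators \<pi>\<^sub>Q \<pi> G L"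
    and "l2_normal \<pi>\<^sub>Q G"
    and "lists_eigenvalues G (\<lambda>i. - eig i)"
  shows "(\<Sum>x\<in>UNIV. \<Sum>y\<in>UNIV. expected_hitting_time MQ X x y * ennreal (\<pi>\<^sub>Q $ x) * ennreal (\<pi>\<^sub>Q $ y)) =
         (\<Sum>x\<in>UNIV. \<Sum>y\<in>UNIV. expected_hitting_time MP Y x y * ennreal (\<pi> $ x) * ennreal (\<pi> $ y)) \<and>
         (\<Sum>x\<in>UNIV. \<Sum>y\<in>UNIV. expected_hitting_time MP Y x y * ennreal (\<pi> $ x) * ennreal (\<pi> $ y)) < \<infinity> \<and>
         complex_of_real (enn2real
           (\<Sum>x\<in>UNIV. \<Sum>y\<in>UNIV. expected_hitting_time MP Y x y * ennreal (\<pi> $ x) * ennreal (\<pi> $ y))) =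
         (\<Sum>i | i \<in> {1..CARD('x)} \<and> eig i \<noteq> 0. 1 / eig i)"
proof -
  have eigL: "lists_eigenvalues L (\<lambda>i. - eig i)"
    using assms(13) similar_generators_charpoly[OF assms(11)] by (simp add: lists_eigenvalues_def)
  obtain s where s: "s \<ge> 0"
    "(\<Sum>x\<in>UNIV. \<Sum>y\<in>UNIV. expected_hitting_time MQ X x y * ennreal (\<pi>\<^sub>Q $ x) * ennreal (\<pi>\<^sub>Q $ y)) = ennreal s"
    "complex_of_real s = (\<Sum>i | i \<in> {1..CARD('x)} \<and> eig i \<noteq> 0. 1 / eig i)"
    using random_target_identity[OF assms(1-5) assms(13)] by blast
  obtain s' where s': "s' \<ge> 0"
    "(\<Sum>x\<in>UNIV. \<Sum>y\<in>UNIV. expected_hitting_time MP Y x y * ennreal (\<pi> $ x) * ennreal (\<pi> $ y)) = ennreal s'"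
    "complex_of_real s' = (\<Sum>i | i \<in> {1..CARD('x)} \<and> eig i \<noteq> 0. 1 / eig i)"
    using random_target_identity[OF assms(6-10) eigL] by blast
  have "s = s'" using s(3) s'(3) by (metis of_real_eq_iff)
  with s s' show ?thesis by simp
qed

end
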